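(* Let $G,H$ be discrete groups with $G\subseteq H$ (a subgroup). If $(\ell^{1}(G),* )\preceq(\ell^{1}(H),* )$ as $\mathcal{L}_{\mathrm{cnv}}$-structures, then $(G,\cdot)\preceq(H,\cdot)$ as (classical first-order) structures in the language of pure groups.
   Context: For a discrete group $G$, $(\ell^1(G),* )$ denotes the convolution algebra of $G$: the real Banach lattice $\ell^1(G)$ (functions $f:G\to\mathbb{R}$ with $\|f\|=\sum_{x}|f(x)|<\infty$, pointwise order) equipped with convolution $(f*g)(x)=\sum_{y\in G}f(y)g(y^{-1}x)$. It is regarded as a metric structure in continuous first-order logic in the language $\mathcal{L}_{\mathrm{cnv}}=\{+,0,\wedge,\vee,\|\cdot\|,*\}$ with metric $d(f,g)=\|f-g\|$; formally one works in the unit ball, treating $+,\wedge,\vee$ as maps from the unit ball to the ball of radius $2$ (or rescaling them by $1/2$). When $G\le H$, $\ell^1(G)$ is viewed as a substructure of $\ell^1(H)$ via extension by zero. $\preceq$ between convolution algebras is elementary substructure in continuous logic. The language of pure groups is $\mathcal{L}_{\mathrm{grp}}=\{\cdot\}$, and $\preceq$ between groups is classical elementary substructure. *)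

theory Defs
  imports
    "HOL-Algebra.Group"
    "HOL-Analysis.Infinite_Sum"
    "HOL-Analysis.Function_Topology"
begin

section \<open>Continuous logic for the language of convolution algebras\<close>

text \<open>
  Everything takes place in the unit ball: the addition and the lattice operations are
  rescaled by 1/2 so that they map the unit ball to itself, and the universe of a structure is
  meant to be a unit ball.
\<close>

record 'm cnv_structure =
  universe :: "'m set"
  cnv_zero :: 'm
  half_add :: "'m \<Rightarrow> 'm \<Rightarrow> 'm"
  half_meet :: "'m \<Rightarrow> 'm \<Rightarrow> 'm"
  half_join :: "'m \<Rightarrow> 'm \<Rightarrow> 'm"
  cnv_mult :: "'m \<Rightarrow> 'm \<Rightarrow> 'm"
  cnv_norm :: "'m \<Rightarrow> real"
  cnv_dist :: "'m \<Rightarrow> 'm \<Rightarrow> real"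

datatype cnv_term =
    CVar nat
  | CZero
  | CAdd cnv_term cnv_term
  | CMeet cnv_term cnv_term
  | CJoin cnv_term cnv_term
  | CMult cnv_term cnv_term

datatype cnv_formula =
    CNorm cnv_term
  | CDist cnv_term cnv_term
  | CConn "real list \<Rightarrow> real" "cnv_formula list"
  | CSup nat cnv_formula
  | CInf nat cnv_formula

text \<open>
  Formulas are real-valued. An \<open>n\<close>-ary connective is a continuous function
  \<open>\<real>\<^sup>n \<rightarrow> \<real>\<close>, given on lists of length \<open>n\<close>. Its continuity is expressed on
  \<open>nat \<Rightarrow> real\<close> with the product topology, of which only the first \<open>n\<close> coordinates are used.
\<close>

primrec cnv_wf :: "cnv_formula \<Rightarrow> bool" where
  "cnv_wf (CNorm t) = True"
| "cnv_wf (CDist t t') = True"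
| "cnv_wf (CConn u \<phi>s) =
     (continuous_on UNIV (\<lambda>v :: nat \<Rightarrow> real. u (map v [0..<length \<phi>s])) \<and>
      list_all (\<lambda>b. b) (map cnv_wf \<phi>s))"
| "cnv_wf (CSup n \<phi>) = cnv_wf \<phi>"
| "cnv_wf (CInf n \<phi>) = cnv_wf \<phi>"

primrec cnv_term_val :: "'m cnv_structure \<Rightarrow> (nat \<Rightarrow> 'm) \<Rightarrow> cnv_term \<Rightarrow> 'm" where
  "cnv_term_val M s (CVar n) = s n"
| "cnv_term_val M s CZero = cnv_zero M"
| "cnv_term_val M s (CAdd t t') = half_add M (cnv_term_val M s t) (cnv_term_val M s t')"
| "cnv_term_val M s (CMeet t t') = half_meet M (cnv_term_val M s t) (cnv_term_val M s t')"
| "cnv_term_val M s (CJoin t t') = half_join M (cnv_term_val M s t) (cnv_term_val M s t')"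
| "cnv_term_val M s (CMult t t') = cnv_mult M (cnv_term_val M s t) (cnv_term_val M s t')"

primrec cnv_val :: "'m cnv_structure \<Rightarrow> cnv_formula \<Rightarrow> (nat \<Rightarrow> 'm) \<Rightarrow> real" where
  "cnv_val M (CNorm t) = (\<lambda>s. cnv_norm M (cnv_term_val M s t))"
| "cnv_val M (CDist t t') = (\<lambda>s. cnv_dist M (cnv_term_val M s t) (cnv_term_val M s t'))"
| "cnv_val M (CConn u \<phi>s) = (\<lambda>s. u (map (\<lambda>e. e s) (map (cnv_val M) \<phi>s)))"
| "cnv_val M (CSup n \<phi>) = (\<lambda>s. SUP x\<in>universe M. cnv_val M \<phi> (s(n := x)))"
| "cnv_val M (CInf n \<phi>) = (\<lambda>s. INF x\<in>universe M. cnv_val M \<phi> (s(n := x)))"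

definition cnv_substructure :: "'m cnv_structure \<Rightarrow> 'm cnv_structure \<Rightarrow> bool" where
  "cnv_substructure M N \<longleftrightarrow>
     universe M \<subseteq> universe N \<and>
     cnv_zero M = cnv_zero N \<and>
     (\<forall>x\<in>universe M. cnv_norm M x = cnv_norm N x) \<and>
     (\<forall>x\<in>universe M. \<forall>y\<in>universe M.
        half_add M x y = half_add N x y \<and>
        half_meet M x y = half_meet N x y \<and>
        half_join M x y = half_join N x y \<and>
        cnv_mult M x y = cnv_mult N x y \<and>
        cnv_dist M x y = cnv_dist N x y)"

definition cnv_elementary_substructure :: "'m cnv_structure \<Rightarrow> 'm cnv_structure \<Rightarrow> bool"
    (infix "\<preceq>\<^sub>c\<^sub>n\<^sub>v" 50) where
  "M \<preceq>\<^sub>c\<^sub>n\<^sub>v N \<longleftrightarrow>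
     cnv_substructure M N \<and>
     (\<forall>\<phi>. cnv_wf \<phi> \<longrightarrow>
        (\<forall>s. range s \<subseteq> universe M \<longrightarrow> cnv_val M \<phi> s = cnv_val N \<phi> s))"

section \<open>The convolution algebra of a discrete group\<close>

text \<open>
  Functions on \<open>carrier G\<close> are represented by functions on the whole type that vanish off
  \<open>carrier G\<close>. Extension by zero along a subgroup is then the identity.
\<close>

definition l1 :: "('a, 'b) monoid_scheme \<Rightarrow> ('a \<Rightarrow> real) set" where
  "l1 G = {f. (\<forall>x. x \<notin> carrier G \<longrightarrow> f x = 0) \<and> (\<lambda>x. \<bar>f x\<bar>) summable_on carrier G}"

definition l1_norm :: "('a, 'b) monoid_scheme \<Rightarrow> ('a \<Rightarrow> real) \<Rightarrow> real" where
  "l1_norm G f = (\<Sum>\<^sub>\<infinity>x\<in>carrier G. \<bar>f x\<bar>)"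

definition convolution ::
    "('a, 'b) monoid_scheme \<Rightarrow> ('a \<Rightarrow> real) \<Rightarrow> ('a \<Rightarrow> real) \<Rightarrow> 'a \<Rightarrow> real" where
  "convolution G f g x =
     (if x \<in> carrier G
      then \<Sum>\<^sub>\<infinity>y\<in>carrier G. f y * g (inv\<^bsub>G\<^esub> y \<otimes>\<^bsub>G\<^esub> x)
      else 0)"

definition l1_algebra :: "('a, 'b) monoid_scheme \<Rightarrow> ('a \<Rightarrow> real) cnv_structure" where
  "l1_algebra G = \<lparr>
     universe = {f \<in> l1 G. l1_norm G f \<le> 1},
     cnv_zero = (\<lambda>x. 0),
     half_add = (\<lambda>f g x. (f x + g x) / 2),
     half_meet = (\<lambda>f g x. min (f x) (g x) / 2),
     half_join = (\<lambda>f g x. max (f x) (g x) / 2),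
     cnv_mult = convolution G,
     cnv_norm = l1_norm G,
     cnv_dist = (\<lambda>f g. l1_norm G (\<lambda>x. f x - g x)) \<rparr>"

section \<open>First-order logic for the language of pure groups\<close>

datatype grp_term = GVar nat | GMult grp_term grp_term

datatype grp_formula =
    GEq grp_term grp_term
  | GNeg grp_formula
  | GAnd grp_formula grp_formula
  | GEx nat grp_formula

primrec grp_term_val :: "('a, 'b) monoid_scheme \<Rightarrow> (nat \<Rightarrow> 'a) \<Rightarrow> grp_term \<Rightarrow> 'a" where
  "grp_term_val G s (GVar n) = s n"
| "grp_term_val G s (GMult t t') = grp_term_val G s t \<otimes>\<^bsub>G\<^esub> grp_term_val G s t'"

primrec grp_sat :: "('a, 'b) monoid_scheme \<Rightarrow> (nat \<Rightarrow> 'a) \<Rightarrow> grp_formula \<Rightarrow> bool" where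
  "grp_sat G s (GEq t t') \<longleftrightarrow> grp_term_val G s t = grp_term_val G s t'"
| "grp_sat G s (GNeg \<phi>) \<longleftrightarrow> \<not> grp_sat G s \<phi>"
| "grp_sat G s (GAnd \<phi> \<psi>) \<longleftrightarrow> grp_sat G s \<phi> \<and> grp_sat G s \<psi>"
| "grp_sat G s (GEx n \<phi>) \<longleftrightarrow> (\<exists>x\<in>carrier G. grp_sat G (s(n := x)) \<phi>)"

definition grp_substructure ::
    "('a, 'b) monoid_scheme \<Rightarrow> ('a, 'b) monoid_scheme \<Rightarrow> bool" where
  "grp_substructure G H \<longleftrightarrow>
     carrier G \<subseteq> carrier H \<and>
     (\<forall>x\<in>carrier G. \<forall>y\<in>carrier G. x \<otimes>\<^bsub>G\<^esub> y = x \<otimes>\<^bsub>H\<^esub> y)"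

definition grp_elementary_substructure ::
    "('a, 'b) monoid_scheme \<Rightarrow> ('a, 'b) monoid_scheme \<Rightarrow> bool"
    (infix "\<preceq>\<^sub>g\<^sub>r\<^sub>p" 50) where
  "G \<preceq>\<^sub>g\<^sub>r\<^sub>p H \<longleftrightarrow>
     grp_substructure G H \<and>
     (\<forall>\<phi> s. range s \<subseteq> carrier G \<longrightarrow> grp_sat G s \<phi> = grp_sat H s \<phi>)"

end

theory Submission
  imports Defs
begin

text \<open>
  The point masses form a copy of the group inside the unit ball of its convolution algebra.
  Each group formula \<open>\<phi>\<close> is translated into a formula of continuous logic that takes exactly
  the value 0 or 1, according to the truth of \<open>\<phi>\<close>, whenever its variables are within some
  \<open>\<epsilon> > 0\<close> of point masses; \<open>\<epsilon>\<close> depends on \<open>\<phi>\<close> but not on the group. For equations this holds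
  because distinct point masses have distance 2. An existential quantifier becomes an infimum
  over the maximum of the translated body and a guard that vanishes at point masses and equals 1
  at distance more than \<open>\<epsilon>\<close> from them. The guard measures how far the positive part of \<open>f\<close> is
  from norm 1, and how well it can be split into two disjoint parts that both have mass.
\<close>

section \<open>The space \<open>\<ell>\<^sup>1\<close>\<close>

definition dirac :: "'a \<Rightarrow> 'a \<Rightarrow> real" where
  "dirac a = (\<lambda>x. if x = a then 1 else 0)"

lemma has_sum_diff:
  fixes f g :: "'i \<Rightarrow> 'b::topological_ab_group_add"
  assumes "(f has_sum a) A" "(g has_sum b) A"
  shows "((\<lambda>x. f x - g x) has_sum (a - b)) A"
  using has_sum_add[OF assms(1), of "\<lambda>x. - g x" "- b"] assms(2) by (simp add: has_sum_uminus)

lemma l1_summable: "f \<in> l1 K \<Longrightarrow> (\<lambda>x. \<bar>f x\<bar>) summable_on carrier K"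
  by (simp add: l1_def)

lemma l1_outside: "f \<in> l1 K \<Longrightarrow> x \<notin> carrier K \<Longrightarrow> f x = 0"
  by (simp add: l1_def)

lemma l1_norm_nonneg: "0 \<le> l1_norm K f"
  by (simp add: l1_norm_def infsum_nonneg)

lemma l1_dominated:
  assumes "g \<in> l1 K" "\<And>x. \<bar>f x\<bar> \<le> \<bar>g x\<bar>"
  shows "f \<in> l1 K" "l1_norm K f \<le> l1_norm K g"
proof -
  have s: "(\<lambda>x. \<bar>f x\<bar>) summable_on carrier K"
    by (rule summable_on_comparison_test[OF l1_summable[OF assms(1)]]) (use assms in auto)
  have "f x = 0" if "x \<notin> carrier K" for x
    using assms(2)[of x] l1_outside[OF assms(1) that] by simp
  with s show "f \<in> l1 K"
    by (simp add: l1_def)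
  show "l1_norm K f \<le> l1_norm K g"
    unfolding l1_norm_def by (rule infsum_mono[OF s l1_summable[OF assms(1)]]) (use assms in auto)
qed

lemma l1_add:
  assumes "f \<in> l1 K" "g \<in> l1 K"
  shows "(\<lambda>x. f x + g x) \<in> l1 K"
    and "l1_norm K (\<lambda>x. f x + g x) \<le> l1_norm K f + l1_norm K g"
proof -
  have s: "(\<lambda>x. \<bar>f x\<bar> + \<bar>g x\<bar>) summable_on carrier K"
    by (intro summable_on_add l1_summable assms)
  have t: "(\<lambda>x. \<bar>f x + g x\<bar>) summable_on carrier K"
    by (rule summable_on_comparison_test[OF s]) auto
  then show "(\<lambda>x. f x + g x) \<in> l1 K"
    using assms by (auto simp: l1_def)
  have "l1_norm K (\<lambda>x. f x + g x) \<le> (\<Sum>\<^sub>\<infinity>x\<in>carrier K. \<bar>f x\<bar> + \<bar>g x\<bar>)"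
    unfolding l1_norm_def by (rule infsum_mono[OF t s]) auto
  also have "\<dots> = l1_norm K f + l1_norm K g"
    unfolding l1_norm_def by (intro infsum_add l1_summable assms)
  finally show "l1_norm K (\<lambda>x. f x + g x) \<le> l1_norm K f + l1_norm K g" .
qed

lemma l1_diff:
  assumes "f \<in> l1 K" "g \<in> l1 K"
  shows "(\<lambda>x. f x - g x) \<in> l1 K"
proof -
  have "(\<lambda>x. - g x) \<in> l1 K"
    by (rule l1_dominated(1)[OF assms(2)]) simp
  from l1_add(1)[OF assms(1) this] show ?thesis
    by simp
qed

lemma l1_norm_minus_commute: "l1_norm K (\<lambda>x. f x - g x) = l1_norm K (\<lambda>x. g x - f x)"
  by (simp add: l1_norm_def abs_minus_commute)

lemma l1_norm_triangle:
  assumes "f \<in> l1 K" "g \<in> l1 K" "h \<in> l1 K"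
  shows "l1_norm K (\<lambda>x. f x - h x)
    \<le> l1_norm K (\<lambda>x. f x - g x) + l1_norm K (\<lambda>x. g x - h x)"
  using l1_add(2)[OF l1_diff[OF assms(1,2)] l1_diff[OF assms(2,3)]] by simp

lemma l1_norm_cmult:
  assumes "0 \<le> c"
  shows "l1_norm K (\<lambda>x. c * f x) = c * l1_norm K f"
  using assms by (simp add: l1_norm_def abs_mult infsum_cmult_right')

lemma abs_le_l1_norm:
  assumes "f \<in> l1 K"
  shows "\<bar>f a\<bar> \<le> l1_norm K f"
proof (cases "a \<in> carrier K")
  case True
  then show ?thesis
    using finite_sum_le_infsum[OF l1_summable[OF assms], of "{a}"] by (simp add: l1_norm_def)
next
  case False
  then show ?thesis
    using assms l1_norm_nonneg by (simp add: l1_outside)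
qed

section \<open>Norms and distances of point masses\<close>

lemma cmult_dirac_has_sum:
  assumes "a \<in> carrier K"
  shows "((\<lambda>x. c * dirac a x) has_sum c) (carrier K)"
  by (rule has_sum_finite_neutralI[of "{a}"]) (use assms in \<open>auto simp: dirac_def\<close>)

lemma dirac_l1:
  assumes "a \<in> carrier K"
  shows "dirac a \<in> l1 K" "l1_norm K (dirac a) = 1"
proof -
  have "((\<lambda>x. \<bar>dirac a x\<bar>) has_sum 1) (carrier K)"
    using cmult_dirac_has_sum[OF assms, of 1] by (simp add: dirac_def)
  then show "dirac a \<in> l1 K" "l1_norm K (dirac a) = 1"
    using assms by (auto simp: l1_def l1_norm_def dirac_def infsumI summable_on_def)
qed

lemma l1_norm_cmult_dirac:
  assumes "a \<in> carrier K" "0 \<le> c"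
  shows "l1_norm K (\<lambda>x. c * dirac a x) = c"
  using assms by (simp add: l1_norm_cmult dirac_l1)

lemma l1_norm_dirac_diff:
  assumes "a \<in> carrier K" "b \<in> carrier K" "a \<noteq> b"
  shows "l1_norm K (\<lambda>x. dirac a x - dirac b x) = 2"
proof -
  have "((\<lambda>x. \<bar>dirac a x - dirac b x\<bar>) has_sum 2) (carrier K)"
    by (rule has_sum_finite_neutralI[of "{a, b}"]) (use assms in \<open>auto simp: dirac_def\<close>)
  then show ?thesis
    by (simp add: l1_norm_def infsumI)
qed

text \<open>Subtracting \<open>dirac a\<close> changes \<open>f\<close> only at \<open>a\<close>,
  where the absolute value goes from \<open>f a\<close> to \<open>1 - f a\<close>. The norm
  therefore changes by \<open>1 - 2 * f a\<close>, starting from at most 1.\<close>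

lemma l1_norm_diff_dirac_le:
  assumes "f \<in> l1 K" "l1_norm K f \<le> 1" "a \<in> carrier K" "0 \<le> f a"
  shows "l1_norm K (\<lambda>x. f x - dirac a x) \<le> 2 * (1 - f a)"
proof -
  have "f a \<le> 1"
    using abs_le_l1_norm[OF assms(1), of a] assms(2) by simp
  then have eq: "\<bar>f x - dirac a x\<bar> = \<bar>f x\<bar> + (1 - 2 * f a) * dirac a x" for x
    using assms(4) by (auto simp: dirac_def)
  have "((\<lambda>x. \<bar>f x\<bar> + (1 - 2 * f a) * dirac a x) has_sum (l1_norm K f + (1 - 2 * f a)))
      (carrier K)"
    unfolding l1_norm_def
    by (intro has_sum_add cmult_dirac_has_sum has_sum_infsum l1_summable assms)
  then have "l1_norm K (\<lambda>x. f x - dirac a x) = l1_norm K f + (1 - 2 * f a)"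
    unfolding l1_norm_def eq by (rule infsumI)
  with assms(2) show ?thesis
    by simp
qed

section \<open>Convolution\<close>

lemma (in group) l1_translate_has_sum:
  assumes "g \<in> l1 G" "y \<in> carrier G"
  shows "((\<lambda>x. \<bar>g (inv y \<otimes> x)\<bar>) has_sum l1_norm G g) (carrier G)"
proof -
  have "bij_betw (\<lambda>x. inv y \<otimes> x) (carrier G) (carrier G)"
    by (rule bij_betwI[where g = "\<lambda>x. y \<otimes> x"]) (use assms in \<open>auto simp: m_assoc[symmetric]\<close>)
  from has_sum_reindex_bij_betw[OF this, where f = "\<lambda>x. \<bar>g x\<bar>"] show ?thesis
    using has_sum_infsum[OF l1_summable[OF assms(1)]] by (simp add: l1_norm_def)
qed

text \<open>Summing over \<open>x\<close> first gives \<open>\<bar>f y\<bar> * l1_norm G g\<close>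
  by translation invariance, which is summable in \<open>y\<close>. Both the pointwise existence of
  the convolution and the later exchange of sums rest on this.\<close>

lemma (in group) convolution_double_summable:
  assumes "f \<in> l1 G" "g \<in> l1 G"
  shows "(\<lambda>(y, x). \<bar>f y * g (inv y \<otimes> x)\<bar>) summable_on carrier G \<times> carrier G"
  by (rule summable_on_SigmaI[where g = "\<lambda>y. \<bar>f y\<bar> * l1_norm G g"])
    (auto simp: abs_mult
      intro!: has_sum_cmult_right l1_translate_has_sum summable_on_cmult_left l1_summable assms)

lemma (in group) convolution_abs_summable:
  assumes "f \<in> l1 G" "g \<in> l1 G" "x \<in> carrier G"
  shows "(\<lambda>y. \<bar>f y * g (inv y \<otimes> x)\<bar>) summable_on carrier G"
proof -
  have "(\<lambda>(x, y). \<bar>f y * g (inv y \<otimes> x)\<bar>) summable_on carrier G \<times> carrier G"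
    using convolution_double_summable[OF assms(1,2)] by (subst (asm) summable_on_swap) simp
  from summable_on_SigmaD1[OF this assms(3)] show ?thesis .
qed

lemma (in group) convolution_summable:
  assumes "f \<in> l1 G" "g \<in> l1 G" "x \<in> carrier G"
  shows "(\<lambda>y. f y * g (inv y \<otimes> x)) summable_on carrier G"
  by (rule abs_summable_summable) (use convolution_abs_summable[OF assms] in simp)

text \<open>The triangle inequality inside the sum, the exchange of sums and translation invariance
  combine. As a consequence the unit ball is closed under convolution.\<close>

lemma (in group) convolution_l1:
  assumes "f \<in> l1 G" "g \<in> l1 G"
  shows "convolution G f g \<in> l1 G"
    and "l1_norm G (convolution G f g) \<le> l1_norm G f * l1_norm G g"
proof -
  let ?c = "\<lambda>y x. \<bar>f y * g (inv y \<otimes> x)\<bar>"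
  have s: "(\<lambda>(x, y). ?c y x) summable_on carrier G \<times> carrier G"
    using convolution_double_summable[OF assms(1,2)] by (subst (asm) summable_on_swap) simp
  have t: "(\<lambda>x. \<Sum>\<^sub>\<infinity>y\<in>carrier G. ?c y x) summable_on carrier G"
    by (rule summable_on_Sigma_banach[OF s])
  have le: "\<bar>convolution G f g x\<bar> \<le> (\<Sum>\<^sub>\<infinity>y\<in>carrier G. ?c y x)" if "x \<in> carrier G" for x
    using norm_infsum_bound[of "\<lambda>y. f y * g (inv y \<otimes> x)" "carrier G"]
      convolution_abs_summable[OF assms that] that
    by (simp add: convolution_def)
  have u: "(\<lambda>x. \<bar>convolution G f g x\<bar>) summable_on carrier G"
    by (rule summable_on_comparison_test[OF t]) (use le in auto)
  then show "convolution G f g \<in> l1 G"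
    by (simp add: l1_def convolution_def)
  have "l1_norm G (convolution G f g) \<le> (\<Sum>\<^sub>\<infinity>x\<in>carrier G. \<Sum>\<^sub>\<infinity>y\<in>carrier G. ?c y x)"
    unfolding l1_norm_def by (rule infsum_mono[OF u t le])
  also have "\<dots> = (\<Sum>\<^sub>\<infinity>y\<in>carrier G. \<Sum>\<^sub>\<infinity>x\<in>carrier G. ?c y x)"
    by (rule infsum_swap_banach[OF s])
  also have "\<dots> = (\<Sum>\<^sub>\<infinity>y\<in>carrier G. \<bar>f y\<bar> * l1_norm G g)"
    using infsumI[OF l1_translate_has_sum[OF assms(2)]]
    by (intro infsum_cong) (simp add: abs_mult infsum_cmult_right')
  also have "\<dots> = l1_norm G f * l1_norm G g"
    by (simp add: l1_norm_def infsum_cmult_left')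
  finally show "l1_norm G (convolution G f g) \<le> l1_norm G f * l1_norm G g" .
qed

lemma (in group) convolution_dirac:
  assumes "a \<in> carrier G" "b \<in> carrier G"
  shows "convolution G (dirac a) (dirac b) = dirac (a \<otimes> b)"
proof
  fix x
  show "convolution G (dirac a) (dirac b) x = dirac (a \<otimes> b) x"
  proof (cases "x \<in> carrier G")
    case True
    have "((\<lambda>y. dirac a y * dirac b (inv y \<otimes> x)) has_sum dirac b (inv a \<otimes> x)) (carrier G)"
      by (rule has_sum_finite_neutralI[of "{a}"]) (use assms in \<open>auto simp: dirac_def\<close>)
    then have "convolution G (dirac a) (dirac b) x = dirac b (inv a \<otimes> x)"
      using True by (simp add: convolution_def infsumI)
    moreover have "inv a \<otimes> x = b \<longleftrightarrow> x = a \<otimes> b"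
      using assms True by (intro inv_solve_left')
    ultimately show ?thesis
      by (simp add: dirac_def)
  next
    case False
    then show ?thesis
      using assms by (auto simp: convolution_def dirac_def)
  qed
qed

text \<open>Telescoping through \<open>convolution G f' g\<close>. Perturbing one factor at a time
  is what makes errors in products additive.\<close>

lemma (in group) convolution_diff:
  assumes "f \<in> l1 G" "g \<in> l1 G" "f' \<in> l1 G" "g' \<in> l1 G"
  shows "convolution G f g x - convolution G f' g' x
    = convolution G (\<lambda>x. f x - f' x) g x + convolution G f' (\<lambda>x. g x - g' x) x"
proof (cases "x \<in> carrier G")
  case True
  have s: "((\<lambda>y. f y * g (inv y \<otimes> x)) has_sum convolution G f g x) (carrier G)"
    if "f \<in> l1 G" "g \<in> l1 G" for f g
    using has_sum_infsum[OF convolution_summable[OF that True]] True by (simp add: convolution_def)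
  have "convolution G (\<lambda>x. f x - f' x) g x = convolution G f g x - convolution G f' g x"
    using infsumI[OF has_sum_diff[OF s[OF assms(1,2)] s[OF assms(3,2)]]] True
    by (simp add: convolution_def left_diff_distrib)
  moreover have "convolution G f' (\<lambda>x. g x - g' x) x = convolution G f' g x - convolution G f' g' x"
    using infsumI[OF has_sum_diff[OF s[OF assms(3,2)] s[OF assms(3,4)]]] True
    by (simp add: convolution_def right_diff_distrib)
  ultimately show ?thesis
    by simp
qed (simp add: convolution_def)

section \<open>Recognising the point masses\<close>

text \<open>The lattice meet of the positive parts. Its norm measures the mass that they share, and
  \<open>pos_meet f f\<close> is the positive part of \<open>f\<close>.\<close>

definition pos_meet :: "('a \<Rightarrow> real) \<Rightarrow> ('a \<Rightarrow> real) \<Rightarrow> 'a \<Rightarrow> real" where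
  "pos_meet f g = (\<lambda>x. min (max (f x) 0) (max (g x) 0))"

lemma pos_meet_l1:
  assumes "f \<in> l1 K"
  shows "pos_meet f g \<in> l1 K" "l1_norm K (pos_meet f g) \<le> l1_norm K f"
  using l1_dominated[OF assms, of "pos_meet f g"] by (auto simp: pos_meet_def)

text \<open>The norms on the left are \<open>max (g a) 0\<close> and \<open>max (h a) 0\<close>, cut
  off at 1, so the smaller one is at most the value of \<open>pos_meet g h\<close> at
  \<open>a\<close>. A point mass can share mass with both \<open>g\<close> and \<open>h\<close> only
  where these overlap.\<close>

lemma pos_meet_dirac_le:
  assumes "a \<in> carrier K" "g \<in> l1 K"
  shows "min (l1_norm K (pos_meet (dirac a) g)) (l1_norm K (pos_meet (dirac a) h))
    \<le> l1_norm K (pos_meet g h)"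
proof -
  have "pos_meet (dirac a) k = (\<lambda>x. min 1 (max (k a) 0) * dirac a x)" for k
    by (auto simp: pos_meet_def dirac_def)
  then have "l1_norm K (pos_meet (dirac a) k) = min 1 (max (k a) 0)" for k
    using l1_norm_cmult_dirac[OF assms(1), of "min 1 (max (k a) 0)"] by simp
  moreover have "pos_meet g h a \<le> l1_norm K (pos_meet g h)"
    using abs_le_l1_norm[OF pos_meet_l1(1)[OF assms(2)], of h a] by linarith
  ultimately show ?thesis
    by (auto simp: pos_meet_def)
qed

text \<open>
  Cutting \<open>f\<^sup>+\<close> along a finite set shows that every finite set carries either almost nothing
  or almost all of its mass. If every single point carried almost nothing, then by induction so
  would every finite set.
\<close>

lemma near_dirac_if_indecomposable:
  assumes f: "f \<in> l1 K" "l1_norm K f \<le> 1"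
    and \<eta>: "0 < \<eta>" "4 * \<eta> \<le> 1"
    and mass: "1 - l1_norm K (pos_meet f f) < \<eta>"
    and indec: "\<And>g h. g \<in> l1 K \<Longrightarrow> l1_norm K g \<le> 1 \<Longrightarrow> h \<in> l1 K \<Longrightarrow> l1_norm K h \<le> 1 \<Longrightarrow>
      min (l1_norm K (pos_meet f g)) (l1_norm K (pos_meet f h)) - l1_norm K (pos_meet g h) < \<eta>"
  shows "\<exists>a\<in>carrier K. l1_norm K (\<lambda>x. f x - dirac a x) \<le> 4 * \<eta>"
proof -
  define p where "p = pos_meet f f"
  define m where "m = l1_norm K p"
  have p0: "0 \<le> p x" for x
    by (simp add: p_def pos_meet_def)
  have p: "p \<in> l1 K" "m \<le> 1"
    using pos_meet_l1[OF f(1), of f] f(2) by (auto simp: p_def m_def)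
  have psum: "(p has_sum m) (carrier K)"
    using has_sum_infsum[OF l1_summable[OF p(1)]] p0 by (simp add: m_def l1_norm_def)
  have dichotomy: "sum p A < \<eta> \<or> m - \<eta> < sum p A" if A: "finite A" "A \<subseteq> carrier K" for A
  proof -
    \<comment> \<open>Restricting \<open>p\<close> to \<open>A\<close> and to its complement gives
      disjoint parts with masses \<open>sum p A\<close> and \<open>m - sum p A\<close>. By
      \<open>indec\<close> the smaller of these is below \<open>\<eta>\<close>.\<close>
    define g where "g = (\<lambda>x. if x \<in> A then p x else 0)"
    define h where "h = (\<lambda>x. if x \<in> A then 0 else p x)"
    have "\<bar>g x\<bar> \<le> \<bar>p x\<bar>" "\<bar>h x\<bar> \<le> \<bar>p x\<bar>" for x
      by (auto simp: g_def h_def)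
    note dom = l1_dominated[OF p(1) this(1)] l1_dominated[OF p(1) this(2)]
    have gh: "g \<in> l1 K" "h \<in> l1 K" "l1_norm K g \<le> 1" "l1_norm K h \<le> 1"
      using dom p(2) by (auto simp: m_def)
    have pm: "pos_meet f g = g" "pos_meet f h = h" "pos_meet g h = (\<lambda>x. 0)"
      by (auto simp: fun_eq_iff g_def h_def p_def pos_meet_def)
    have gsum: "(g has_sum sum p A) (carrier K)"
      by (rule has_sum_finite_neutralI[of A]) (use A in \<open>auto simp: g_def\<close>)
    then have ng: "l1_norm K g = sum p A"
      using p0 by (simp add: l1_norm_def infsumI g_def)
    have "((\<lambda>x. p x - g x) has_sum (m - sum p A)) (carrier K)"
      by (rule has_sum_diff[OF psum gsum])
    moreover have "(\<lambda>x. p x - g x) = (\<lambda>x. \<bar>h x\<bar>)"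
      using p0 by (auto simp: g_def h_def)
    ultimately have nh: "l1_norm K h = m - sum p A"
      by (simp add: l1_norm_def infsumI)
    have "l1_norm K (\<lambda>x. 0) = 0"
      by (simp add: l1_norm_def)
    with indec[OF gh(1,3,2,4)] show ?thesis
      unfolding pm ng nh by linarith
  qed
  have "\<exists>a\<in>carrier K. m - \<eta> < p a"
  proof (rule ccontr)
    assume none: "\<not> ?thesis"
    have small: "p a < \<eta>" if "a \<in> carrier K" for a
      using dichotomy[of "{a}"] none that by auto
    have "sum p A < \<eta>" if "finite A" "A \<subseteq> carrier K" for A
      using that
    proof (induction A rule: finite_induct)
      case empty
      then show ?case
        using \<eta> by simp
    next
      case (insert a A)
      \<comment> \<open>One more light point keeps the sum below \<open>2 * \<eta>\<close>. As
        \<open>1 - \<eta> < m\<close> and \<open>4 * \<eta> \<le> 1\<close>, this is below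
        \<open>m - \<eta>\<close>, so the dichotomy restores the bound
        \<open>\<eta>\<close>.\<close>
      then have "sum p (insert a A) < 2 * \<eta>"
        using small[of a] by simp
      then show ?case
        using dichotomy[of "insert a A"] insert.hyps insert.prems mass \<eta>
        by (auto simp: m_def p_def)
    qed
    \<comment> \<open>Some finite set carries at least \<open>m - \<eta>\<close>, which exceeds
      \<open>\<eta>\<close>.\<close>
    moreover obtain A where "finite A" "A \<subseteq> carrier K" "dist (sum p A) m \<le> \<eta>"
      using has_sum_finite_approximation[OF psum \<eta>(1)] by blast
    ultimately show False
      using mass \<eta> by (force simp: dist_real_def m_def p_def)
  qed
  then obtain a where a: "a \<in> carrier K" "m - \<eta> < p a"
    by blast
  then have "1 - 2 * \<eta> < p a"
    using mass by (simp add: m_def p_def)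
  \<comment> \<open>The bound is positive, so the positive part of \<open>f\<close> at
    \<open>a\<close> is \<open>f a\<close> itself. The distance \<open>2 * (1 - f a)\<close> then
    stays below \<open>4 * \<eta>\<close>.\<close>
  then have "1 - 2 * \<eta> < f a"
    using \<eta> by (auto simp: p_def pos_meet_def max_def split: if_splits)
  then show ?thesis
    using l1_norm_diff_dirac_le[OF f a(1)] \<eta> a(1) by (intro bexI[of _ a]) auto
qed

section \<open>Translating group formulas\<close>

text \<open>Saturation turns a quantity with a gap in its range into one with the exact values 0 and
  1.\<close>

definition clip :: "real \<Rightarrow> real" where
  "clip x = max 0 (min 1 x)"

lemma clip_bounds: "0 \<le> clip x" "clip x \<le> 1"
  by (auto simp: clip_def)

definition pos_meet_term :: "nat \<Rightarrow> nat \<Rightarrow> cnv_term" where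
  "pos_meet_term i j = CMeet (CJoin (CVar i) CZero) (CJoin (CVar j) CZero)"

text \<open>
  The factor 4 compensates the two nested rescalings by 1/2 in \<^const>\<open>pos_meet_term\<close>.
\<close>

definition splitting :: "real \<Rightarrow> nat \<Rightarrow> cnv_formula" where
  "splitting \<eta> n = CConn (\<lambda>v. clip (4 * (min (v ! 0) (v ! 1) - v ! 2) / \<eta>))
     [CNorm (pos_meet_term n (n + 1)), CNorm (pos_meet_term n (n + 2)),
      CNorm (pos_meet_term (n + 1) (n + 2))]"

text \<open>The value reaches 1 once the mass deficit or some splitting reaches
  \<open>\<eta>\<close>. A value below 1 thus yields the strict hypotheses \<open>mass\<close> and
  \<open>indec\<close> of \<open>near_dirac_if_indecomposable\<close>. The bound indices
  \<open>n + 1\<close> and \<open>n + 2\<close> differ from the free variable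
  \<open>n\<close>.\<close>

definition dirac_guard :: "real \<Rightarrow> nat \<Rightarrow> cnv_formula" where
  "dirac_guard \<eta> n = CConn (\<lambda>v. max (clip ((1 - 4 * v ! 0) / \<eta>)) (v ! 1))
     [CNorm (pos_meet_term n n), CSup (n + 1) (CSup (n + 2) (splitting \<eta> n))]"

text \<open>The number of factors, each of which contributes its own error to the product.\<close>

primrec grp_term_length :: "grp_term \<Rightarrow> nat" where
  "grp_term_length (GVar n) = 1"
| "grp_term_length (GMult t t') = grp_term_length t + grp_term_length t'"

primrec cnv_of_grp_term :: "grp_term \<Rightarrow> cnv_term" where
  "cnv_of_grp_term (GVar n) = CVar n"
| "cnv_of_grp_term (GMult t t') = CMult (cnv_of_grp_term t) (cnv_of_grp_term t')"

text \<open>In an equation the errors of the two sides then add up to at most 1/2. A quantifier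
  keeps the tolerance of its body, since its guard is tuned to it.\<close>

primrec tolerance :: "grp_formula \<Rightarrow> real" where
  "tolerance (GEq t t') = 1 / (2 * (real (grp_term_length t) + real (grp_term_length t')))"
| "tolerance (GNeg \<phi>) = tolerance \<phi>"
| "tolerance (GAnd \<phi> \<psi>) = min (tolerance \<phi>) (tolerance \<psi>)"
| "tolerance (GEx n \<phi>) = tolerance \<phi>"

text \<open>The value 0 stands for truth, so conjunction becomes a maximum. In an equation the
  distance is at most 1/2 or at least 3/2, hence the shift by 1/2. Dividing the tolerance by 4
  offsets the factor 4 in \<open>near_dirac_if_indecomposable\<close>.\<close>

primrec cnv_of_grp :: "grp_formula \<Rightarrow> cnv_formula" where
  "cnv_of_grp (GEq t t') =
     CConn (\<lambda>v. clip (v ! 0 - 1 / 2)) [CDist (cnv_of_grp_term t) (cnv_of_grp_term t')]"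
| "cnv_of_grp (GNeg \<phi>) = CConn (\<lambda>v. 1 - v ! 0) [cnv_of_grp \<phi>]"
| "cnv_of_grp (GAnd \<phi> \<psi>) = CConn (\<lambda>v. max (v ! 0) (v ! 1)) [cnv_of_grp \<phi>, cnv_of_grp \<psi>]"
| "cnv_of_grp (GEx n \<phi>) =
     CInf n (CConn (\<lambda>v. max (v ! 0) (v ! 1)) [dirac_guard (tolerance \<phi> / 4) n, cnv_of_grp \<phi>])"

lemma grp_term_length_ge_1: "1 \<le> grp_term_length t"
  by (induction t) auto

lemma tolerance_bounds: "0 < tolerance \<phi> \<and> tolerance \<phi> \<le> 1"
proof (induction \<phi>)
  case (GEq t t')
  have "1 \<le> real (grp_term_length t)" "1 \<le> real (grp_term_length t')"
    using grp_term_length_ge_1 by simp_all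
  then show ?case
    by (auto simp: field_simps)
qed auto

section \<open>Continuity of the connectives\<close>

lemma continuous_on_coordinate: "continuous_on UNIV (\<lambda>v :: nat \<Rightarrow> real. v i)"
  by (rule continuous_on_product_then_coordinatewise) (rule continuous_on_id)

lemma continuous_on_clip:
  "continuous_on S f \<Longrightarrow> continuous_on S (\<lambda>v. clip (f v))"
  unfolding clip_def by (intro continuous_intros)

lemmas continuous_connective_intros =
  continuous_on_clip continuous_on_coordinate continuous_on_max continuous_on_min
  continuous_on_diff continuous_on_mult continuous_on_const

lemma cnv_wf_splitting: "cnv_wf (splitting \<eta> n)"
  \<comment> \<open>Division by \<open>\<eta>\<close> becomes multiplication by a constant, to which
    the product rule for continuity applies.\<close>
  unfolding splitting_def divide_inverse
  by (simp add: nth_append) (intro continuous_connective_intros)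

lemma cnv_wf_dirac_guard: "cnv_wf (dirac_guard \<eta> n)"
  unfolding dirac_guard_def divide_inverse
  by (simp add: nth_append cnv_wf_splitting) (intro continuous_connective_intros)

lemma cnv_wf_cnv_of_grp: "cnv_wf (cnv_of_grp \<phi>)"
proof (induction \<phi>)
  case (GEq t t')
  show ?case
    by simp (intro continuous_connective_intros)
next
  case (GNeg \<phi>)
  then show ?case
    by simp (intro continuous_connective_intros)
next
  case (GAnd \<phi> \<psi>)
  then show ?case
    by (simp add: nth_append) (intro continuous_connective_intros)
next
  case (GEx n \<phi>)
  then show ?case
    by (simp add: nth_append cnv_wf_dirac_guard) (intro continuous_connective_intros)
qed

section \<open>Values of the guard and of translated formulas\<close>

lemma universe_l1_algebra: "universe (l1_algebra K) = {f \<in> l1 K. l1_norm K f \<le> 1}"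
  by (simp add: l1_algebra_def)

lemma zero_in_universe: "(\<lambda>x. 0) \<in> universe (l1_algebra K)"
  by (simp add: l1_algebra_def l1_def l1_norm_def)

lemma cnv_val_pos_meet_term:
  "cnv_val (l1_algebra K) (CNorm (pos_meet_term i j)) s = l1_norm K (pos_meet (s i) (s j)) / 4"
proof -
  have "cnv_term_val (l1_algebra K) s (pos_meet_term i j) = (\<lambda>x. 1 / 4 * pos_meet (s i) (s j) x)"
    by (auto simp: fun_eq_iff l1_algebra_def pos_meet_term_def pos_meet_def min_def max_def)
  then show ?thesis
    using l1_norm_cmult[of "1 / 4" K "pos_meet (s i) (s j)"] by (simp add: l1_algebra_def)
qed

lemma cnv_val_splitting:
  "cnv_val (l1_algebra K) (splitting \<eta> n) (s(n + 1 := g, n + 2 := h))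
    = clip ((min (l1_norm K (pos_meet (s n) g)) (l1_norm K (pos_meet (s n) h))
        - l1_norm K (pos_meet g h)) / \<eta>)"
  by (simp add: splitting_def cnv_val_pos_meet_term min_def del: cnv_val.simps(1))

text \<open>A real \<open>SUP\<close> is a least upper bound only for nonempty bounded families.
  Every supremum in the translation is over values in the unit interval, and it stays there, so
  suprema can be nested.\<close>

lemma SUP_unit_interval:
  fixes F :: "'i \<Rightarrow> real"
  assumes "A \<noteq> {}" "\<And>x. x \<in> A \<Longrightarrow> 0 \<le> F x \<and> F x \<le> 1"
  shows "0 \<le> (SUP x\<in>A. F x)" "(SUP x\<in>A. F x) \<le> 1" "\<And>x. x \<in> A \<Longrightarrow> F x \<le> (SUP x\<in>A. F x)"
proof -
  show le: "F x \<le> (SUP x\<in>A. F x)" if "x \<in> A" for x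
    by (rule cSUP_upper[OF that]) (use assms in \<open>auto simp: bdd_above_def\<close>)
  show "(SUP x\<in>A. F x) \<le> 1"
    by (rule cSUP_least) (use assms in auto)
  from assms(1) obtain x where "x \<in> A"
    by blast
  with le assms(2) show "0 \<le> (SUP x\<in>A. F x)"
    by force
qed

lemma INF_unit_interval:
  fixes F :: "'i \<Rightarrow> real"
  assumes "A \<noteq> {}" "\<And>x. x \<in> A \<Longrightarrow> 0 \<le> F x \<and> F x \<le> 1"
  shows "0 \<le> (INF x\<in>A. F x)" "(INF x\<in>A. F x) \<le> 1" "\<And>x. x \<in> A \<Longrightarrow> (INF x\<in>A. F x) \<le> F x"
proof -
  show le: "(INF x\<in>A. F x) \<le> F x" if "x \<in> A" for x
    by (rule cINF_lower[OF _ that]) (use assms in \<open>auto simp: bdd_below_def\<close>)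
  show "0 \<le> (INF x\<in>A. F x)"
    by (rule cINF_greatest) (use assms in auto)
  from assms(1) obtain x where "x \<in> A"
    by blast
  with le assms(2) show "(INF x\<in>A. F x) \<le> 1"
    by force
qed

lemma splitting_SUP:
  fixes K :: "('a, 'b) monoid_scheme" and \<eta> :: real and n :: nat
  defines "M \<equiv> l1_algebra K"
  defines "S \<equiv> \<lambda>s g. SUP h\<in>universe M. cnv_val M (splitting \<eta> n) (s(n + 1 := g, n + 2 := h))"
  shows "0 \<le> S s g" "S s g \<le> 1"
    and "h \<in> universe M \<Longrightarrow> cnv_val M (splitting \<eta> n) (s(n + 1 := g, n + 2 := h)) \<le> S s g"
    and "0 \<le> (SUP g\<in>universe M. S s g)" "(SUP g\<in>universe M. S s g) \<le> 1"
    and "g \<in> universe M \<Longrightarrow> S s g \<le> (SUP g\<in>universe M. S s g)"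
proof -
  have ne: "universe M \<noteq> {}"
    using zero_in_universe M_def by blast
  have b: "0 \<le> cnv_val M (splitting \<eta> n) (s(n + 1 := g, n + 2 := h))
      \<and> cnv_val M (splitting \<eta> n) (s(n + 1 := g, n + 2 := h)) \<le> 1" for g h
    unfolding M_def cnv_val_splitting using clip_bounds by blast
  note S = SUP_unit_interval[OF ne, where
      F = "\<lambda>h. cnv_val M (splitting \<eta> n) (s(n + 1 := g, n + 2 := h))" for g, OF b]
  have S01: "0 \<le> S s g \<and> S s g \<le> 1" for g
    unfolding S_def using S(1,2) by blast
  then show "0 \<le> S s g" "S s g \<le> 1"
    by simp_all
  show "h \<in> universe M \<Longrightarrow> cnv_val M (splitting \<eta> n) (s(n + 1 := g, n + 2 := h)) \<le> S s g"
    unfolding S_def by (rule S(3))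
  note T = SUP_unit_interval[OF ne S01]
  show "0 \<le> (SUP g\<in>universe M. S s g)" "(SUP g\<in>universe M. S s g) \<le> 1"
    by (rule T(1), rule T(2))
  show "g \<in> universe M \<Longrightarrow> S s g \<le> (SUP g\<in>universe M. S s g)"
    by (rule T(3))
qed

lemma cnv_val_dirac_guard:
  "cnv_val (l1_algebra K) (dirac_guard \<eta> n) s =
    max (clip ((1 - l1_norm K (pos_meet (s n) (s n))) / \<eta>))
      (SUP g\<in>universe (l1_algebra K). SUP h\<in>universe (l1_algebra K).
        cnv_val (l1_algebra K) (splitting \<eta> n) (s(n + 1 := g, n + 2 := h)))"
  by (simp add: dirac_guard_def cnv_val_pos_meet_term del: cnv_val.simps(1))

lemma dirac_guard_bounds:
  "0 \<le> cnv_val (l1_algebra K) (dirac_guard \<eta> n) s"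
  "cnv_val (l1_algebra K) (dirac_guard \<eta> n) s \<le> 1"
  unfolding cnv_val_dirac_guard le_max_iff_disj max.bounded_iff
  using splitting_SUP(4,5)[of K \<eta> n s] clip_bounds by blast+

text \<open>The positive part of a point mass has norm 1, and by \<open>pos_meet_dirac_le\<close> no
  splitting is positive, so both entries of the maximum vanish.\<close>

lemma dirac_guard_dirac:
  assumes "s n = dirac a" "a \<in> carrier K" "0 < \<eta>"
  shows "cnv_val (l1_algebra K) (dirac_guard \<eta> n) s = 0"
proof -
  let ?U = "universe (l1_algebra K)"
  have ne: "?U \<noteq> {}"
    using zero_in_universe by blast
  have "pos_meet (dirac a) (dirac a) = dirac a"
    by (auto simp: pos_meet_def dirac_def)
  then have 1: "l1_norm K (pos_meet (s n) (s n)) = 1"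
    using assms dirac_l1(2) by simp
  have "cnv_val (l1_algebra K) (splitting \<eta> n) (s(n + 1 := g, n + 2 := h)) = 0"
    if "g \<in> ?U" for g h
  proof -
    have "g \<in> l1 K"
      using that by (simp add: universe_l1_algebra)
    from pos_meet_dirac_le[OF assms(2) this, of h]
    have "(min (l1_norm K (pos_meet (s n) g)) (l1_norm K (pos_meet (s n) h))
        - l1_norm K (pos_meet g h)) / \<eta> \<le> 0"
      using assms(1,3) by (intro divide_nonpos_pos) auto
    then show ?thesis
      unfolding cnv_val_splitting clip_def by linarith
  qed
  then have "(SUP g\<in>?U. SUP h\<in>?U.
      cnv_val (l1_algebra K) (splitting \<eta> n) (s(n + 1 := g, n + 2 := h))) = 0"
    using ne by (simp cong: SUP_cong)
  then show ?thesis
    unfolding cnv_val_dirac_guard 1 by (simp add: clip_def)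
qed

text \<open>If the guard is not saturated, neither is any clipped quantity below it, so each
  numerator is less than \<open>\<eta>\<close>. These are the conditions under which
  \<open>near_dirac_if_indecomposable\<close> produces a point mass.\<close>

lemma dirac_guard_near:
  assumes "s n \<in> universe (l1_algebra K)" "0 < \<eta>" "4 * \<eta> \<le> 1"
    and less: "cnv_val (l1_algebra K) (dirac_guard \<eta> n) s < 1"
  shows "\<exists>a\<in>carrier K. l1_norm K (\<lambda>x. s n x - dirac a x) \<le> 4 * \<eta>"
proof (rule near_dirac_if_indecomposable)
  have clip_less: "x < \<eta>" if "clip (x / \<eta>) < 1" for x
    using that assms(2) by (auto simp: clip_def min_def divide_simps split: if_splits)
  show "s n \<in> l1 K" "l1_norm K (s n) \<le> 1"
    using assms(1) by (auto simp: universe_l1_algebra)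
  show "1 - l1_norm K (pos_meet (s n) (s n)) < \<eta>"
    using less unfolding cnv_val_dirac_guard by (intro clip_less) simp
  fix g h
  assume "g \<in> l1 K" "l1_norm K g \<le> 1" "h \<in> l1 K" "l1_norm K h \<le> 1"
  then have gh: "g \<in> universe (l1_algebra K)" "h \<in> universe (l1_algebra K)"
    by (auto simp: universe_l1_algebra)
  have "cnv_val (l1_algebra K) (splitting \<eta> n) (s(n + 1 := g, n + 2 := h)) < 1"
    using splitting_SUP(3)[OF gh(2), of \<eta> n s g] splitting_SUP(6)[OF gh(1), of \<eta> n s] less
    unfolding cnv_val_dirac_guard by linarith
  then show "min (l1_norm K (pos_meet (s n) g)) (l1_norm K (pos_meet (s n) h))
      - l1_norm K (pos_meet g h) < \<eta>"
    unfolding cnv_val_splitting by (rule clip_less)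
qed (use assms in auto)

text \<open>The infimum for \<open>GEx\<close> also ranges over elements far from point masses,
  where the translated body has no logical meaning. Bounds for arbitrary assignments make it a
  genuine greatest lower bound.\<close>

lemma cnv_val_cnv_of_grp_bounds:
  "0 \<le> cnv_val (l1_algebra K) (cnv_of_grp \<phi>) s \<and> cnv_val (l1_algebra K) (cnv_of_grp \<phi>) s \<le> 1"
proof (induction \<phi> arbitrary: s)
  case (GEx n \<phi>)
  have ne: "universe (l1_algebra K) \<noteq> {}"
    using zero_in_universe by blast
  have "0 \<le> max (cnv_val (l1_algebra K) (dirac_guard \<eta> n) s')
        (cnv_val (l1_algebra K) (cnv_of_grp \<phi>) s')
      \<and> max (cnv_val (l1_algebra K) (dirac_guard \<eta> n) s')
        (cnv_val (l1_algebra K) (cnv_of_grp \<phi>) s') \<le> 1" for \<eta> s'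
    using GEx[of s'] dirac_guard_bounds[of K \<eta> n s'] by simp
  from INF_unit_interval(1,2)[OF ne this] show ?case
    by simp
qed (auto simp: clip_bounds le_max_iff_disj)

section \<open>Correctness of the translation near point masses\<close>

lemma (in group) grp_term_val_closed:
  "range r \<subseteq> carrier G \<Longrightarrow> grp_term_val G r t \<in> carrier G"
  by (induction t) auto

text \<open>By \<open>convolution_diff\<close> the error of a product is the sum of the errors of
  its factors, each multiplied by an element of norm at most 1. Membership in the unit ball is
  carried through the induction to supply that bound.\<close>

lemma (in group) cnv_term_val_near_dirac:
  assumes "range s \<subseteq> universe (l1_algebra G)" "range r \<subseteq> carrier G"
    and "\<And>i. l1_norm G (\<lambda>x. s i x - dirac (r i) x) \<le> \<epsilon>"
  shows "cnv_term_val (l1_algebra G) s (cnv_of_grp_term t) \<in> universe (l1_algebra G) \<and>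
    l1_norm G (\<lambda>x. cnv_term_val (l1_algebra G) s (cnv_of_grp_term t) x
      - dirac (grp_term_val G r t) x) \<le> real (grp_term_length t) * \<epsilon>"
proof (induction t)
  case (GVar n)
  then show ?case
    using assms by auto
next
  case (GMult t t')
  define f f' a a' where "f = cnv_term_val (l1_algebra G) s (cnv_of_grp_term t)"
    and "f' = cnv_term_val (l1_algebra G) s (cnv_of_grp_term t')"
    and "a = grp_term_val G r t" and "a' = grp_term_val G r t'"
  have f: "f \<in> l1 G" "f' \<in> l1 G" "l1_norm G f \<le> 1" "l1_norm G f' \<le> 1"
    using GMult by (auto simp: f_def f'_def universe_l1_algebra)
  have le: "l1_norm G (\<lambda>x. f x - dirac a x) \<le> real (grp_term_length t) * \<epsilon>"
    "l1_norm G (\<lambda>x. f' x - dirac a' x) \<le> real (grp_term_length t') * \<epsilon>"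
    using GMult by (auto simp: f_def f'_def a_def a'_def)
  have a: "a \<in> carrier G" "a' \<in> carrier G"
    using grp_term_val_closed[OF assms(2)] by (auto simp: a_def a'_def)
  note d = dirac_l1(1)[OF a(1)] dirac_l1(1)[OF a(2)]
  note e = l1_diff[OF f(1) d(1)] l1_diff[OF f(2) d(2)]
  have "l1_norm G (\<lambda>x. convolution G f f' x - dirac (a \<otimes> a') x)
      = l1_norm G (\<lambda>x. convolution G (\<lambda>x. f x - dirac a x) f' x
          + convolution G (dirac a) (\<lambda>x. f' x - dirac a' x) x)"
    unfolding convolution_dirac[OF a, symmetric] convolution_diff[OF f(1,2) d] ..
  also have "\<dots> \<le> l1_norm G (convolution G (\<lambda>x. f x - dirac a x) f')
      + l1_norm G (convolution G (dirac a) (\<lambda>x. f' x - dirac a' x))"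
    by (intro l1_add convolution_l1 f d e)
  also have "\<dots> \<le> l1_norm G (\<lambda>x. f x - dirac a x) * l1_norm G f'
      + l1_norm G (dirac a) * l1_norm G (\<lambda>x. f' x - dirac a' x)"
    by (intro add_mono convolution_l1 f d e)
  also have "\<dots> \<le> l1_norm G (\<lambda>x. f x - dirac a x) * 1 + 1 * l1_norm G (\<lambda>x. f' x - dirac a' x)"
    using f(4) dirac_l1(2)[OF a(1)] by (intro add_mono mult_left_mono) (auto simp: l1_norm_nonneg)
  also have "\<dots> \<le> real (grp_term_length (GMult t t')) * \<epsilon>"
    using le by (simp add: distrib_right)
  finally have near: "l1_norm G (\<lambda>x. convolution G f f' x - dirac (a \<otimes> a') x)
      \<le> real (grp_term_length (GMult t t')) * \<epsilon>" .
  have "l1_norm G (convolution G f f') \<le> 1"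
    using convolution_l1(2)[OF f(1,2)] f mult_le_one[of "l1_norm G f" "l1_norm G f'"] l1_norm_nonneg
    by fastforce
  then have "convolution G f f' \<in> universe (l1_algebra G)"
    using convolution_l1(1)[OF f(1,2)] by (simp add: universe_l1_algebra)
  moreover have "cnv_term_val (l1_algebra G) s (cnv_of_grp_term (GMult t t')) = convolution G f f'"
    by (simp add: l1_algebra_def f_def f'_def)
  ultimately show ?case
    using near by (simp add: a_def a'_def)
qed

text \<open>The induction covers assignments merely near point masses, because an element passing
  the guard is only known to be near one. Since the values are exactly 0 or 1, negation introduces
  no further error.\<close>

lemma (in group) cnv_val_cnv_of_grp:
  assumes "range s \<subseteq> universe (l1_algebra G)" "range r \<subseteq> carrier G"
    and "\<And>i. l1_norm G (\<lambda>x. s i x - dirac (r i) x) \<le> tolerance \<phi>"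
  shows "cnv_val (l1_algebra G) (cnv_of_grp \<phi>) s = (if grp_sat G r \<phi> then 0 else 1)"
  using assms
proof (induction \<phi> arbitrary: s r)
  case (GEq t t')
  define f f' a a' where "f = cnv_term_val (l1_algebra G) s (cnv_of_grp_term t)"
    and "f' = cnv_term_val (l1_algebra G) s (cnv_of_grp_term t')"
    and "a = grp_term_val G r t" and "a' = grp_term_val G r t'"
  note near = cnv_term_val_near_dirac[OF GEq]
  have f: "f \<in> l1 G" "f' \<in> l1 G"
    using near by (auto simp: f_def f'_def universe_l1_algebra)
  have a: "a \<in> carrier G" "a' \<in> carrier G"
    using grp_term_val_closed[OF GEq(2)] by (auto simp: a_def a'_def)
  note d = dirac_l1(1)[OF a(1)] dirac_l1(1)[OF a(2)]
  let ?d = "\<lambda>g h. l1_norm G (\<lambda>x. g x - h x)"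
  have "0 < real (grp_term_length t) + real (grp_term_length t')"
    using grp_term_length_ge_1[of t] by linarith
  then have "real (grp_term_length t) * tolerance (GEq t t')
      + real (grp_term_length t') * tolerance (GEq t t') = 1 / 2"
    unfolding distrib_right[symmetric] by simp
  then have e: "?d f (dirac a) + ?d f' (dirac a') \<le> 1 / 2"
    using near[of t] near[of t'] unfolding f_def f'_def a_def a'_def by linarith
  have val: "cnv_val (l1_algebra G) (cnv_of_grp (GEq t t')) s = clip (?d f f' - 1 / 2)"
    by (simp add: f_def f'_def l1_algebra_def)
  show ?case
  proof (cases "a = a'")
    case True
    then have "?d f f' \<le> 1 / 2"
      using l1_norm_triangle[OF f(1) d(1) f(2)] e l1_norm_minus_commute[of G f' "dirac a"] by simp
    then show ?thesis
      unfolding val using True by (simp add: clip_def a_def a'_def)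
  next
    case False
    \<comment> \<open>Distinct point masses are at distance 2. A total error of at most 1/2 leaves
      3/2, just enough for \<open>clip\<close> to saturate after the shift.\<close>
    have "2 \<le> ?d (dirac a) f + ?d f f' + ?d f' (dirac a')"
      using l1_norm_dirac_diff[OF a False] l1_norm_triangle[OF d(1) f(1) d(2)]
        l1_norm_triangle[OF f d(2)] by linarith
    then have "3 / 2 \<le> ?d f f'"
      using e l1_norm_minus_commute[of G f "dirac a"] by linarith
    then show ?thesis
      unfolding val using False by (simp add: clip_def a_def a'_def)
  qed
next
  case (GNeg \<phi>)
  then show ?case
    by simp
next
  case (GAnd \<phi> \<psi>)
  then show ?case
    by simp
next
  case (GEx n \<phi>)
  let ?U = "universe (l1_algebra G)"
  define \<eta> where "\<eta> = tolerance \<phi> / 4"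
  define F where "F x = max (cnv_val (l1_algebra G) (dirac_guard \<eta> n) (s(n := x)))
    (cnv_val (l1_algebra G) (cnv_of_grp \<phi>) (s(n := x)))" for x
  have \<eta>: "0 < \<eta>" "4 * \<eta> \<le> 1"
    using tolerance_bounds[of \<phi>] by (auto simp: \<eta>_def)
  have val: "cnv_val (l1_algebra G) (cnv_of_grp (GEx n \<phi>)) s = (INF x\<in>?U. F x)"
    by (simp add: F_def \<eta>_def)
  have ne: "?U \<noteq> {}"
    using zero_in_universe by blast
  have F01: "0 \<le> F x \<and> F x \<le> 1" for x
    using dirac_guard_bounds[of G \<eta> n "s(n := x)"] cnv_val_cnv_of_grp_bounds[of G \<phi> "s(n := x)"]
    by (simp add: F_def)
  note INF = INF_unit_interval[where F = F, OF ne F01]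
  have IH: "cnv_val (l1_algebra G) (cnv_of_grp \<phi>) (s(n := x))
      = (if grp_sat G (r(n := a)) \<phi> then 0 else 1)"
    if "x \<in> ?U" "a \<in> carrier G" "l1_norm G (\<lambda>y. x y - dirac a y) \<le> tolerance \<phi>" for x a
    using that GEx.prems by (intro GEx.IH) auto
  show ?case
  proof (cases "grp_sat G r (GEx n \<phi>)")
    case True
    then obtain a where a: "a \<in> carrier G" "grp_sat G (r(n := a)) \<phi>"
      by auto
    \<comment> \<open>The point mass of the group witness makes both the guard and the body vanish,
      so the infimum is attained with value 0.\<close>
    have U: "dirac a \<in> ?U"
      using dirac_l1[OF a(1)] by (simp add: universe_l1_algebra)
    have "l1_norm G (\<lambda>y. dirac a y - dirac a y) \<le> tolerance \<phi>"
      using tolerance_bounds[of \<phi>] by (simp add: l1_norm_def)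
    from IH[OF U a(1) this] a(2) have "F (dirac a) = 0"
      using dirac_guard_dirac[of "s(n := dirac a)" n a G \<eta>] a(1) \<eta>(1) by (simp add: F_def)
    then show ?thesis
      using val INF(1) INF(3)[OF U] True by simp
  next
    case False
    \<comment> \<open>Either the guard is already 1, or \<open>x\<close> is near some point mass
      \<open>a\<close>. In the latter case the body fails at \<open>a\<close>, so its translation
      has value 1.\<close>
    have "1 \<le> F x" if x: "x \<in> ?U" for x
    proof (cases "cnv_val (l1_algebra G) (dirac_guard \<eta> n) (s(n := x)) < 1")
      case True
      then obtain a where "a \<in> carrier G" "l1_norm G (\<lambda>y. x y - dirac a y) \<le> tolerance \<phi>"
        using dirac_guard_near[of "s(n := x)" n G \<eta>] x \<eta> by (auto simp: \<eta>_def)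
      from IH[OF x this] show ?thesis
        using False \<open>a \<in> carrier G\<close> by (auto simp: F_def)
    qed (simp add: F_def)
    then have "1 \<le> (INF x\<in>?U. F x)"
      by (intro cINF_greatest ne)
    then show ?thesis
      using val INF(2) False by simp
  qed
qed

section \<open>From elementarity of the algebras to elementarity of the groups\<close>

lemma (in group) cnv_val_cnv_of_grp_dirac:
  assumes "range r \<subseteq> carrier G"
  shows "cnv_val (l1_algebra G) (cnv_of_grp \<phi>) (\<lambda>i. dirac (r i)) = (if grp_sat G r \<phi> then 0 else 1)"
proof (rule cnv_val_cnv_of_grp[OF _ assms])
  show "range (\<lambda>i. dirac (r i)) \<subseteq> universe (l1_algebra G)"
    using assms dirac_l1[of _ G] by (auto simp: universe_l1_algebra)
  show "l1_norm G (\<lambda>x. dirac (r i) x - dirac (r i) x) \<le> tolerance \<phi>" for i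
    using tolerance_bounds[of \<phi>] by (simp add: l1_norm_def)
qed

theorem theorem3p16:
  fixes H :: "('a, 'b) monoid_scheme" and G :: "'a set"
  assumes "group H"
    and "subgroup G H"
    and "l1_algebra (H\<lparr>carrier := G\<rparr>) \<preceq>\<^sub>c\<^sub>n\<^sub>v l1_algebra H"
  shows "H\<lparr>carrier := G\<rparr> \<preceq>\<^sub>g\<^sub>r\<^sub>p H"
proof -
  let ?G = "H\<lparr>carrier := G\<rparr>"
  have sub: "G \<subseteq> carrier H"
    by (rule subgroup.subset[OF assms(2)])
  have grp: "group ?G"
    by (rule subgroup.subgroup_is_group[OF assms(2,1)])
  have "grp_sat ?G r \<phi> = grp_sat H r \<phi>" if r: "range r \<subseteq> G" for \<phi> r
  proof -
    \<comment> \<open>Extension by zero sends point masses to point masses, so the same functions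
      serve as parameters in both algebras.\<close>
    have "range (\<lambda>i. dirac (r i)) \<subseteq> universe (l1_algebra ?G)"
      using r dirac_l1[of _ ?G] by (auto simp: universe_l1_algebra)
    then have "cnv_val (l1_algebra ?G) (cnv_of_grp \<phi>) (\<lambda>i. dirac (r i))
        = cnv_val (l1_algebra H) (cnv_of_grp \<phi>) (\<lambda>i. dirac (r i))"
      using assms(3) cnv_wf_cnv_of_grp unfolding cnv_elementary_substructure_def by blast
    moreover have "range r \<subseteq> carrier ?G" "range r \<subseteq> carrier H"
      using r sub by auto
    \<comment> \<open>The common value is 0 or 1 and decides the truth of \<open>\<phi>\<close> in
      both groups.\<close>
    ultimately show ?thesis
      using group.cnv_val_cnv_of_grp_dirac[OF grp, of r \<phi>]
        group.cnv_val_cnv_of_grp_dirac[OF assms(1), of r \<phi>]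
      by (simp split: if_splits)
  qed
  then show ?thesis
    using sub by (simp add: grp_elementary_substructure_def grp_substructure_def)
qed

end
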